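(* Let $\mathcal{T}\subset\mathbb{R}$ be the support of the treatment, let $\mathcal{Y}\subset\mathbb{R}$ be bounded, and let $\mathcal{X}$ be a Euclidean set. Let $\mathbf{P}^*_{\mathrm{UC}}$ be the structural model consisting of all joint distributions $P^*$ of $(\{Y(t)\}_{t\in\mathcal{T}},T,X)$, with values in $\mathcal{Y}^{\mathcal{T}}\times\mathcal{T}\times\mathcal{X}$, such that $Y(t)\perp T\mid X$ for every $t\in\mathcal{T}$ under $P^*$. Let $\mathbf{P}_{\mathrm{UC}}=\{P^*\circ s^{-1}:P^*\in\mathbf{P}^*_{\mathrm{UC}}\}$ be the induced statistical model, where $s(\{Y(t)\}_{t\in\mathcal{T}},T,X)=(Y(T),T,X)$. Then $\mathbf{P}_{\mathrm{UC}}$ is globally just identified, that is, $$\mathbf{P}_{\mathrm{UC}}=\mathbf{M}(\mathcal{Y}\times\mathcal{T}\times\mathcal{X}).$$ Hence the model is locally just identified, that is, every $P\in\mathbf{P}_{\mathrm{UC}}$ is locally just identified by $\mathbf{P}_{\mathrm{UC}}$.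
   Context: For a Euclidean set $\mathcal{W}$, $\mathbf{M}(\mathcal{W})$ denotes the set of all probability measures on $\mathcal{W}$ with its Borel $\sigma$-algebra. The sets $\mathcal{Y},\mathcal{T},\mathcal{X}$ are Borel subsets of Euclidean spaces. An element of the structural model is the joint distribution of random variables $(\{Y(t)\}_{t\in\mathcal{T}},T,X)$ (potential outcomes, treatment, covariates) such that the observed outcome $Y=Y(T)$ is a random variable; $P^*\circ s^{-1}$ is the resulting distribution of the observables $(Y,T,X)=(Y(T),T,X)$ (the pushforward of $P^*$ by $s$). A statistical model $\mathbf{P}\subset\mathbf{M}(\mathcal{W})$ is globally just identified if $\mathbf{P}=\mathbf{M}(\mathcal{W})$. For $P\in\mathbf{P}$ let $L^2_0(P)=\{g:\mathcal{W}\to\mathbb{R}:\int g\,dP=0,\ \int g^2\,dP<\infty\}$. A path with score $g\in L_0^2(P)$ is a map $\theta\mapsto P_{\theta,g}$ from some $[0,\bar\theta)$ to $\mathbf{M}(\mathcal{W})$ with $P_{0,g}=P$ and $$\lim_{\theta\downarrow 0}\int\Big(\frac{\sqrt{p_{\theta,g}(w)}-\sqrt{p(w)}}{\theta}-\tfrac12 g(w)\sqrt{p(w)}\Big)^2d\mu_\theta(w)=0,$$ where $\mu_\theta$ is a $\sigma$-finite positive measure dominating $P_{\theta,g}+P$, and $p_{\theta,g},p$ are the densities of $P_{\theta,g},P$ with respect to $\mu_\theta$. The tangent space $\bar{\mathscr{T}}(P)$ of $\mathbf{P}$ at $P$ is the closed linear span in $L^2_0(P)$ of the set of scores $g$ of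 paths with $P_{\theta,g}\in\mathbf{P}$ for all $\theta$. $P$ is locally just identified by $\mathbf{P}$ if $\bar{\mathscr{T}}(P)=L^2_0(P)$. *)

theory Defs
  imports "HOL-Probability.Probability"
begin

definition prob_measures :: "'w::euclidean_space set \<Rightarrow> 'w measure set" where
  "prob_measures W = {P. prob_space P \<and> sets P = sets (restrict_space borel W)}"

definition globally_just_identified ::
  "'w::euclidean_space set \<Rightarrow> 'w measure set \<Rightarrow> bool" where
  "globally_just_identified W \<P> \<longleftrightarrow> \<P> = prob_measures W"

text \<open>
  Elements of \<open>L\<^sup>2\<close> are represented by functions on the whole ambient type, of which only the
  restriction to \<open>space P\<close> matters; functions that agree almost everywhere are not identified.
\<close>

definition L2_zero :: "'w measure \<Rightarrow> ('w \<Rightarrow> real) set" where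
  "L2_zero P = {g. g \<in> borel_measurable P \<and> integrable P (\<lambda>w. (g w)\<^sup>2) \<and> (\<integral>w. g w \<partial>P) = 0}"

text \<open>
  The integral in the limit does not depend on the choice of the dominating measures \<open>\<mu> \<theta>\<close>.
  It is written as a Lebesgue integral with values in \<open>[0, \<infinity>]\<close>, so that no convention about
  non-integrable functions enters. A measure dominates a sum of two positive measures iff it
  dominates both.
\<close>

definition path_with_score ::
  "'w::euclidean_space set \<Rightarrow> 'w measure \<Rightarrow> ('w \<Rightarrow> real) \<Rightarrow> real \<Rightarrow> (real \<Rightarrow> 'w measure) \<Rightarrow> bool"
where
  "path_with_score W P g b Q \<longleftrightarrow>
     g \<in> L2_zero P \<and> 0 < b \<and> Q 0 = P \<and> (\<forall>\<theta>\<in>{0..<b}. Q \<theta> \<in> prob_measures W) \<and>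
     (\<exists>\<mu> :: real \<Rightarrow> 'w measure.
        (\<forall>\<theta>\<in>{0..<b}. sigma_finite_measure (\<mu> \<theta>) \<and> sets (\<mu> \<theta>) = sets (restrict_space borel W) \<and>
            absolutely_continuous (\<mu> \<theta>) (Q \<theta>) \<and> absolutely_continuous (\<mu> \<theta>) P) \<and>
        ((\<lambda>\<theta>. \<integral>\<^sup>+ w. ennreal
             (((sqrt (enn2real (RN_deriv (\<mu> \<theta>) (Q \<theta>) w)) - sqrt (enn2real (RN_deriv (\<mu> \<theta>) P w))) / \<theta>
               - 1 / 2 * g w * sqrt (enn2real (RN_deriv (\<mu> \<theta>) P w)))\<^sup>2) \<partial>\<mu> \<theta>)
           \<longlongrightarrow> 0) (at_right 0))"

definition scores ::
  "'w::euclidean_space set \<Rightarrow> 'w measure set \<Rightarrow> 'w measure \<Rightarrow> ('w \<Rightarrow> real) set" where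
  "scores W \<P> P = {g. \<exists>b Q. path_with_score W P g b Q \<and> (\<forall>\<theta>\<in>{0..<b}. Q \<theta> \<in> \<P>)}"

definition fun_span :: "('w \<Rightarrow> real) set \<Rightarrow> ('w \<Rightarrow> real) set" where
  "fun_span S = {(\<lambda>w. \<Sum>f\<in>F. c f * f w) | F c. finite F \<and> F \<subseteq> S}"

definition L2_zero_closure :: "'w measure \<Rightarrow> ('w \<Rightarrow> real) set \<Rightarrow> ('w \<Rightarrow> real) set" where
  "L2_zero_closure P V =
     {g \<in> L2_zero P. \<forall>\<epsilon>>0. \<exists>h\<in>V. sqrt (\<integral>w. (g w - h w)\<^sup>2 \<partial>P) < \<epsilon>}"

definition tangent_space ::
  "'w::euclidean_space set \<Rightarrow> 'w measure set \<Rightarrow> 'w measure \<Rightarrow> ('w \<Rightarrow> real) set" where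
  "tangent_space W \<P> P = L2_zero_closure P (fun_span (scores W \<P> P))"

definition locally_just_identified ::
  "'w::euclidean_space set \<Rightarrow> 'w measure set \<Rightarrow> 'w measure \<Rightarrow> bool" where
  "locally_just_identified W \<P> P \<longleftrightarrow> tangent_space W \<P> P = L2_zero P"

definition cond_indep_var ::
  "'a measure \<Rightarrow> 'b measure \<Rightarrow> ('a \<Rightarrow> 'b) \<Rightarrow> 'c measure \<Rightarrow> ('a \<Rightarrow> 'c) \<Rightarrow> 'd measure \<Rightarrow> ('a \<Rightarrow> 'd) \<Rightarrow> bool"
where
  "cond_indep_var M N\<^sub>U U N\<^sub>V V N\<^sub>Z Z \<longleftrightarrow>
     U \<in> M \<rightarrow>\<^sub>M N\<^sub>U \<and> V \<in> M \<rightarrow>\<^sub>M N\<^sub>V \<and> Z \<in> M \<rightarrow>\<^sub>M N\<^sub>Z \<and>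
     (\<forall>A\<in>sets N\<^sub>U. \<forall>B\<in>sets N\<^sub>V. AE \<omega> in M.
        real_cond_exp M (vimage_algebra (space M) Z N\<^sub>Z)
          (indicator (U -` A \<inter> V -` B \<inter> space M)) \<omega> =
        real_cond_exp M (vimage_algebra (space M) Z N\<^sub>Z) (indicator (U -` A \<inter> space M)) \<omega> *
        real_cond_exp M (vimage_algebra (space M) Z N\<^sub>Z) (indicator (V -` B \<inter> space M)) \<omega>)"

text \<open>A point is \<open>(y, t, x)\<close> with \<open>y\<close> the path of potential outcomes, \<open>t\<close> the treatment and \<open>x\<close> the covariates.\<close>

definition observe :: "('t \<Rightarrow> 'y) \<times> 't \<times> 'x \<Rightarrow> 'y \<times> 't \<times> 'x" where
  "observe = (\<lambda>(y, t, x). (y t, t, x))"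

definition structural_product ::
  "'y::euclidean_space set \<Rightarrow> 't::euclidean_space set \<Rightarrow> 'x::euclidean_space set \<Rightarrow>
   (('t \<Rightarrow> 'y) \<times> 't \<times> 'x) measure" where
  "structural_product Y T X =
     (\<Pi>\<^sub>M t\<in>T. restrict_space borel Y) \<Otimes>\<^sub>M restrict_space borel T \<Otimes>\<^sub>M restrict_space borel X"

text \<open>
  For uncountable \<open>T\<close> the evaluation \<open>(y, t) \<mapsto> y t\<close> is in general not measurable for the product
  \<open>\<sigma>\<close>-algebra. A family \<open>(Y(t))\<^sub>t, T, X\<close> of random variables for which \<open>Y(T)\<close> is a random
  variable as well has a joint distribution on the \<open>\<sigma>\<close>-algebra generated by all of these.
\<close>

definition structural_space ::
  "'y::euclidean_space set \<Rightarrow> 't::euclidean_space set \<Rightarrow> 'x::euclidean_space set \<Rightarrow>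
   (('t \<Rightarrow> 'y) \<times> 't \<times> 'x) measure" where
  "structural_space Y T X =
     sigma (space (structural_product Y T X))
       (sets (structural_product Y T X) \<union>
        sets (vimage_algebra (space (structural_product Y T X)) observe borel))"

definition structural_UC ::
  "'y::euclidean_space set \<Rightarrow> 't::euclidean_space set \<Rightarrow> 'x::euclidean_space set \<Rightarrow>
   (('t \<Rightarrow> 'y) \<times> 't \<times> 'x) measure set" where
  "structural_UC Y T X =
     {P. prob_space P \<and> sets P = sets (structural_space Y T X) \<and>
         (\<forall>t\<in>T. cond_indep_var P borel (\<lambda>(y, _, _). y t) borel (\<lambda>(_, d, _). d) borel (\<lambda>(_, _, x). x))}"

definition model_UC ::
  "'y::euclidean_space set \<Rightarrow> 't::euclidean_space set \<Rightarrow> 'x::euclidean_space set \<Rightarrow>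
   ('y \<times> 't \<times> 'x) measure set" where
  "model_UC Y T X = (\<lambda>P. distr P (restrict_space borel (Y \<times> T \<times> X)) observe) ` structural_UC Y T X"

end

theory Submission
  imports Defs
begin

text \<open>
  A distribution \<open>P\<close> of \<open>(Y, T, X)\<close> is realised by the potential outcomes \<open>Y(t) = Q(U, t, X)\<close>,
  where \<open>Q(\<cdot>, t, x)\<close> is the conditional quantile function of \<open>Y\<close> given \<open>(T, X) = (t, x)\<close> and \<open>U\<close> is
  uniform and independent of \<open>(T, X)\<close>: then \<open>(Q(U, T, X), T, X)\<close> has law \<open>P\<close>, and given \<open>X\<close> the
  variable \<open>Y(t)\<close> depends on \<open>U\<close> only. So the model contains every distribution, and in particular
  the paths with density \<open>1 + \<theta> g\<close> with respect to \<open>P\<close>, for every bounded \<open>g\<close> of mean zero. Such \<open>g\<close>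
  are dense in \<open>L2_zero P\<close>.
\<close>

subsection \<open>Scores of the unrestricted model\<close>

text \<open>With \<open>r = sqrt (1 + s)\<close> the remainder is exactly
  \<open>- (r - 1)\<^sup>2 / 2\<close>, and \<open>s = (r - 1) * (r + 1)\<close> with
  \<open>r + 1 \<ge> 1\<close> bounds the modulus of \<open>r - 1\<close> by that of
  \<open>s\<close>. The estimate thus reaches down to \<open>s = - 1\<close>, where the derivative
  of the root blows up.\<close>

lemma sqrt_one_plus_expansion:
  assumes "- 1 \<le> (s::real)"
  shows "\<bar>sqrt (1 + s) - 1 - s / 2\<bar> \<le> s\<^sup>2 / 2"
proof -
  define r where "r = sqrt (1 + s)"
  have r: "0 \<le> r" "r\<^sup>2 = 1 + s" using assms by (auto simp: r_def)
  have s: "s = (r - 1) * (r + 1)" using r(2) by (simp add: algebra_simps power2_eq_square)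
  have "r - 1 - s / 2 = - ((r - 1)\<^sup>2 / 2)" unfolding s by (simp add: field_simps power2_eq_square)
  moreover have "(r - 1)\<^sup>2 * 1 \<le> (r - 1)\<^sup>2 * (r + 1)\<^sup>2"
    by (intro mult_left_mono) (use r(1) in \<open>auto simp: one_le_power\<close>)
  then have "(r - 1)\<^sup>2 \<le> s\<^sup>2" by (simp add: s power_mult_distrib)
  ultimately show ?thesis unfolding r_def[symmetric] by simp
qed

text \<open>The path tilts \<open>P\<close> by the density \<open>1 + \<theta> * g\<close>, of total
  mass one because \<open>g\<close> has mean zero, and \<open>P\<close> itself dominates the whole
  path. The square-root expansion bounds the quantity squared in the path condition by
  \<open>\<theta> * K\<^sup>2 / 2\<close>, uniformly over the sample space.\<close>

lemma bounded_mean_zero_is_score: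
  fixes g :: "'w::euclidean_space \<Rightarrow> real"
  assumes P: "P \<in> prob_measures W" and g: "g \<in> L2_zero P" and K: "\<And>w. \<bar>g w\<bar> \<le> K"
  shows "g \<in> scores W (prob_measures W) P"
proof -
  interpret prob_space P using P by (simp add: prob_measures_def)
  have [measurable]: "g \<in> borel_measurable P" and mean: "(\<integral>w. g w \<partial>P) = 0"
    using g by (auto simp: L2_zero_def)
  have K0: "0 \<le> K" using K[of undefined] by linarith
  \<comment> \<open>This range keeps \<open>\<theta> * g w\<close> within \<open>[-1, 1]\<close>, so
    the density stays nonnegative; adding 1 to \<open>K\<close> covers \<open>K = 0\<close>.\<close>
  define b where "b = 1 / (K + 1)"
  have b: "0 < b" using K0 by (simp add: b_def)
  have small: "\<bar>\<theta> * g w\<bar> \<le> 1" if "\<theta> \<in> {0..<b}" for \<theta> w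
  proof -
    have "\<bar>\<theta> * g w\<bar> \<le> b * K" unfolding abs_mult using that K[of w] by (intro mult_mono) auto
    also have "\<dots> \<le> 1" using K0 by (simp add: b_def)
    finally show ?thesis .
  qed
  define Q where "Q \<theta> = density P (\<lambda>w. ennreal (1 + \<theta> * g w))" for \<theta>
  have intg: "integrable P g" by (rule integrable_const_bound[of _ K]) (use K in auto)
  have Q: "Q \<theta> \<in> prob_measures W" if "\<theta> \<in> {0..<b}" for \<theta>
  proof -
    have "(\<integral>\<^sup>+w. ennreal (1 + \<theta> * g w) \<partial>P) = ennreal (\<integral>w. 1 + \<theta> * g w \<partial>P)"
    proof (rule nn_integral_eq_integral)
      show "AE w in P. 0 \<le> 1 + \<theta> * g w"
        using small[OF that] by (intro AE_I2) (smt (verit))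
    qed (use intg in auto)
    also have "\<dots> = 1" using intg mean by (simp add: prob_space)
    finally have "emeasure (Q \<theta>) (space P) = 1"
      by (simp add: Q_def emeasure_density cong: nn_integral_cong)
    then have "prob_space (Q \<theta>)" by (intro prob_spaceI) (simp add: Q_def)
    then show ?thesis using P by (simp add: prob_measures_def Q_def)
  qed
  \<comment> \<open>\<open>RN_deriv\<close> is determined only almost everywhere, so the explicit
    densities can replace it only under the integral.\<close>
  have RN_P: "AE w in P. 1 = RN_deriv P P w"
    by (rule RN_deriv_unique) (auto simp: density_1)
  have RN_Q: "AE w in P. ennreal (1 + \<theta> * g w) = RN_deriv P (Q \<theta>) w" for \<theta>
    by (rule RN_deriv_unique) (auto simp: Q_def)
  define I where "I \<theta> = (\<integral>\<^sup>+ w. ennreal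
             (((sqrt (enn2real (RN_deriv P (Q \<theta>) w)) - sqrt (enn2real (RN_deriv P P w))) / \<theta>
               - 1 / 2 * g w * sqrt (enn2real (RN_deriv P P w)))\<^sup>2) \<partial>P)" for \<theta>
  have I: "I \<theta> \<le> ennreal ((\<theta> * K\<^sup>2 / 2)\<^sup>2)" if "\<theta> \<in> {0<..<b}" for \<theta>
  proof -
    have "I \<theta> \<le> (\<integral>\<^sup>+w. ennreal ((\<theta> * K\<^sup>2 / 2)\<^sup>2) \<partial>P)"
      unfolding I_def
    proof (rule nn_integral_mono_AE, use RN_P RN_Q[of \<theta>] in eventually_elim)
      case (elim w)
      have th: "\<theta> \<in> {0..<b}" "0 < \<theta>" using that by auto
      have s: "- 1 \<le> \<theta> * g w" using small[OF th(1), of w] by linarith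
      have "\<bar>(sqrt (1 + \<theta> * g w) - 1) / \<theta> - 1 / 2 * g w\<bar> = \<bar>sqrt (1 + \<theta> * g w) - 1 - \<theta> * g w / 2\<bar> / \<theta>"
        using th by (simp add: abs_div_pos diff_divide_distrib)
      also have "\<dots> \<le> ((\<theta> * g w)\<^sup>2 / 2) / \<theta>"
        using sqrt_one_plus_expansion[OF s] th by (intro divide_right_mono) auto
      also have "\<dots> = \<theta> * (g w)\<^sup>2 / 2" using th by (simp add: power2_eq_square)
      also have "\<dots> \<le> \<theta> * K\<^sup>2 / 2"
        using K[of w] th abs_le_square_iff[of "g w" K] K0 by (intro divide_right_mono mult_left_mono) auto
      finally have "((sqrt (1 + \<theta> * g w) - 1) / \<theta> - 1 / 2 * g w)\<^sup>2 \<le> (\<theta> * K\<^sup>2 / 2)\<^sup>2"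
        by (metis abs_ge_zero power2_abs power_mono)
      then show ?case unfolding elim(1,2)[symmetric] using s by (auto intro!: ennreal_leI)
    qed
    then show ?thesis by (simp add: emeasure_space_1)
  qed
  have "(I \<longlongrightarrow> 0) (at_right 0)"
  proof (rule tendsto_sandwich[OF _ _ tendsto_const])
    show "\<forall>\<^sub>F \<theta> in at_right 0. I \<theta> \<le> ennreal ((\<theta> * K\<^sup>2 / 2)\<^sup>2)"
      using I b by (auto simp: eventually_at_right_field)
    have "((\<lambda>\<theta>. (\<theta> * K\<^sup>2 / 2)\<^sup>2) \<longlongrightarrow> (0 * K\<^sup>2 / 2)\<^sup>2) (at_right 0)"
      by (intro tendsto_intros) auto
    from tendsto_ennrealI[OF this]
    show "((\<lambda>\<theta>. ennreal ((\<theta> * K\<^sup>2 / 2)\<^sup>2)) \<longlongrightarrow> 0) (at_right 0)"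
      by simp
  qed auto
  moreover have "absolutely_continuous P (Q \<theta>)" for \<theta>
    unfolding Q_def by (rule absolutely_continuousI_density) simp
  moreover have "absolutely_continuous P P" by (simp add: absolutely_continuous_def)
  moreover have "Q 0 = P" by (simp add: Q_def density_1)
  moreover have "sets P = sets (restrict_space borel W)" using P by (simp add: prob_measures_def)
  ultimately have "path_with_score W P g b Q"
    unfolding path_with_score_def I_def using g b Q sigma_finite_measure_axioms
    by (intro conjI exI[of _ "\<lambda>_. P"]) auto
  then show ?thesis unfolding scores_def using Q by blast
qed

text \<open>Truncation at level \<open>n\<close> destroys the mean-zero property, which subtracting
  the mean \<open>m n\<close> restores. These means tend to the mean of \<open>g\<close>, which is
  zero, so dominated convergence gives convergence in mean square.\<close>

lemma bounded_dense_in_L2_zero: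
  assumes "prob_space P" and g: "g \<in> L2_zero P" and "0 < \<epsilon>"
  obtains h K where "h \<in> L2_zero P" "\<And>w. \<bar>h w\<bar> \<le> K" "sqrt (\<integral>w. (g w - h w)\<^sup>2 \<partial>P) < \<epsilon>"
proof -
  interpret prob_space P by fact
  have [measurable]: "g \<in> borel_measurable P" and int2: "integrable P (\<lambda>w. (g w)\<^sup>2)"
    and mean: "(\<integral>w. g w \<partial>P) = 0"
    using g by (auto simp: L2_zero_def)
  have int1: "integrable P g" by (rule square_integrable_imp_integrable) (use int2 in auto)
  \<comment> \<open>The truncation acts on the whole type and not just on \<open>space P\<close>,
    because the bound on a score was assumed at every point.\<close>
  define c where "c n w = max (- real n) (min (real n) (g w))" for n w
  have c_meas[measurable]: "c n \<in> borel_measurable P" for n unfolding c_def by measurable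
  have c_bd: "\<bar>c n w\<bar> \<le> real n" for n w by (auto simp: c_def)
  have c_le: "\<bar>c n w\<bar> \<le> \<bar>g w\<bar>" for n w by (auto simp: c_def)
  have c_lim: "(\<lambda>n. c n w) \<longlonglongrightarrow> g w" for w
  proof (rule tendsto_eventually)
    obtain N where N: "\<bar>g w\<bar> \<le> real N" using real_arch_simple by blast
    show "\<forall>\<^sub>F n in sequentially. c n w = g w"
      using eventually_ge_at_top[of N] by eventually_elim (use N in \<open>auto simp: c_def\<close>)
  qed
  define m where "m n = (\<integral>w. c n w \<partial>P)" for n
  have c_int: "integrable P (c n)" for n
    by (rule integrable_const_bound[of _ "real n"]) (use c_bd in auto)
  have m_lim: "m \<longlonglongrightarrow> 0"
    unfolding m_def mean[symmetric]
    by (rule integral_dominated_convergence[where w="\<lambda>w. \<bar>g w\<bar>"]) (use int1 c_lim c_le in auto)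
  then obtain B where B: "\<And>n. \<bar>m n\<bar> \<le> B"
    by (metis convergentI convergent_imp_Bseq BseqE real_norm_def)
  define h where "h n w = c n w - m n" for n w
  have h_meas[measurable]: "h n \<in> borel_measurable P" for n unfolding h_def by measurable
  have "(\<lambda>n. \<integral>w. (g w - h n w)\<^sup>2 \<partial>P) \<longlonglongrightarrow> (\<integral>w. 0 \<partial>P)"
  proof (rule integral_dominated_convergence[where w="\<lambda>w. 8 * (g w)\<^sup>2 + 2 * B\<^sup>2"])
    show "AE w in P. (\<lambda>n. (g w - h n w)\<^sup>2) \<longlonglongrightarrow> 0"
    proof (rule AE_I2)
      fix w
      have "(\<lambda>n. (g w - (c n w - m n))\<^sup>2) \<longlonglongrightarrow> (g w - (g w - 0))\<^sup>2"
        by (intro tendsto_intros c_lim m_lim)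
      then show "(\<lambda>n. (g w - h n w)\<^sup>2) \<longlonglongrightarrow> 0" by (simp add: h_def)
    qed
    show "AE w in P. norm ((g w - h n w)\<^sup>2) \<le> 8 * (g w)\<^sup>2 + 2 * B\<^sup>2" for n
    proof (rule AE_I2)
      fix w
      have "\<bar>m n\<bar> \<le> \<bar>B\<bar>" "\<bar>g w - c n w\<bar> \<le> \<bar>2 * g w\<bar>"
        using B[of n] c_le[of n w] by auto
      then have "(m n)\<^sup>2 \<le> B\<^sup>2" "(g w - c n w)\<^sup>2 \<le> 4 * (g w)\<^sup>2"
        unfolding abs_le_square_iff by (simp_all add: power_mult_distrib)
      \<comment> \<open>Parallelogram identity for \<open>g w - c n w\<close> and
        \<open>m n\<close>; dropping the second square on the left yields the integrable
        majorant.\<close>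
      moreover have "(g w - h n w)\<^sup>2 + (g w - c n w - m n)\<^sup>2 = 2 * (g w - c n w)\<^sup>2 + 2 * (m n)\<^sup>2"
        by (simp add: h_def power2_eq_square algebra_simps)
      ultimately show "norm ((g w - h n w)\<^sup>2) \<le> 8 * (g w)\<^sup>2 + 2 * B\<^sup>2"
        unfolding real_norm_def abs_power2
        using zero_le_power2[of "g w - c n w - m n"] by linarith
    qed
  qed (use int2 in auto)
  then have "(\<lambda>n. sqrt (\<integral>w. (g w - h n w)\<^sup>2 \<partial>P)) \<longlonglongrightarrow> sqrt 0"
    by (intro tendsto_real_sqrt) simp
  then have "\<forall>\<^sub>F n in sequentially. sqrt (\<integral>w. (g w - h n w)\<^sup>2 \<partial>P) < \<epsilon>"
    using \<open>0 < \<epsilon>\<close> by (intro order_tendstoD) auto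
  then obtain n where n: "sqrt (\<integral>w. (g w - h n w)\<^sup>2 \<partial>P) < \<epsilon>"
    by (auto simp: eventually_sequentially)
  have bd: "\<bar>h n w\<bar> \<le> real n + B" for w using c_bd[of n w] B[of n] by (auto simp: h_def)
  have "h n \<in> L2_zero P"
    unfolding L2_zero_def
  proof (intro CollectI conjI)
    have "(h n w)\<^sup>2 \<le> (real n + B)\<^sup>2" for w
      using bd[of w] by (simp flip: abs_le_square_iff)
    then show "integrable P (\<lambda>w. (h n w)\<^sup>2)"
      by (intro integrable_const_bound[of _ "(real n + B)\<^sup>2"]) auto
    show "(\<integral>w. h n w \<partial>P) = 0"
      unfolding h_def using c_int[of n] by (simp add: prob_space m_def)
  qed simp
  then show thesis using bd n that by blast
qed

text \<open>The dense bounded functions are scores themselves, so a one-term combination already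
  approximates; linear span and paths of any other form are not called upon. The other inclusion is
  built into the closure, which is taken inside \<open>L2_zero P\<close>.\<close>

lemma locally_just_identified_all_measures:
  fixes P :: "'w::euclidean_space measure"
  assumes P: "P \<in> prob_measures W"
  shows "locally_just_identified W (prob_measures W) P"
  unfolding locally_just_identified_def tangent_space_def
proof (intro equalityI subsetI)
  fix g assume g: "g \<in> L2_zero P"
  show "g \<in> L2_zero_closure P (fun_span (scores W (prob_measures W) P))"
    unfolding L2_zero_closure_def
  proof (intro CollectI conjI allI impI g)
    fix \<epsilon> :: real assume "0 < \<epsilon>"
    moreover have "prob_space P" using P by (simp add: prob_measures_def)
    ultimately obtain h K where h: "h \<in> L2_zero P" "\<And>w. \<bar>h w\<bar> \<le> K"
      "sqrt (\<integral>w. (g w - h w)\<^sup>2 \<partial>P) < \<epsilon>"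
      using bounded_dense_in_L2_zero g by blast
    then have "h \<in> scores W (prob_measures W) P" using bounded_mean_zero_is_score P by blast
    then have "h \<in> fun_span (scores W (prob_measures W) P)"
      unfolding fun_span_def by (intro CollectI exI[of _ "\<lambda>_. 1"] exI[of _ "{h}"]) auto
    with h(3) show "\<exists>h\<in>fun_span (scores W (prob_measures W) P). sqrt (\<integral>w. (g w - h w)\<^sup>2 \<partial>P) < \<epsilon>"
      by blast
  qed
qed (simp add: L2_zero_closure_def)

subsection \<open>Conditional quantile functions\<close>

text \<open>On the set where \<open>g < f\<close> the two integrals must coincide, so the strictly
  positive \<open>f - g\<close> has integral zero there and the set is null. Finiteness of the
  integral of \<open>f\<close> is what permits the subtraction in
  \<open>[0, \<infinity>]\<close>.\<close>

lemma AE_le_of_set_nn_integral_le: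
  assumes f[measurable]: "f \<in> borel_measurable M" and g[measurable]: "g \<in> borel_measurable M"
    and fin: "(\<integral>\<^sup>+x. f x \<partial>M) \<noteq> \<infinity>"
    and le: "\<And>A. A \<in> sets M \<Longrightarrow> (\<integral>\<^sup>+x\<in>A. f x \<partial>M) \<le> (\<integral>\<^sup>+x\<in>A. g x \<partial>M)"
  shows "AE x in M. f x \<le> g x"
proof -
  define A where "A = {x \<in> space M. g x < f x}"
  have A[measurable]: "A \<in> sets M" unfolding A_def by measurable
  have fin': "(\<integral>\<^sup>+x\<in>A. f x \<partial>M) < \<infinity>"
    by (rule le_less_trans[OF nn_integral_mono[of M _ f]]) (use fin in \<open>auto simp: indicator_def less_top\<close>)
  have "(\<integral>\<^sup>+x\<in>A. g x \<partial>M) \<le> (\<integral>\<^sup>+x\<in>A. f x \<partial>M)"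
    by (intro nn_integral_mono) (auto simp: A_def indicator_def)
  with le[OF A] have eq: "(\<integral>\<^sup>+x\<in>A. f x \<partial>M) = (\<integral>\<^sup>+x\<in>A. g x \<partial>M)" by simp
  have "(\<integral>\<^sup>+x. f x * indicator A x - g x * indicator A x \<partial>M) =
      (\<integral>\<^sup>+x\<in>A. f x \<partial>M) - (\<integral>\<^sup>+x\<in>A. g x \<partial>M)"
    using fin' eq by (intro nn_integral_diff) (auto simp: A_def indicator_def less_imp_le less_top)
  also have "\<dots> = 0" using fin' eq by (simp add: less_top)
  finally have "AE x in M. f x * indicator A x - g x * indicator A x = 0"
    by (subst (asm) nn_integral_0_iff_AE) auto
  with AE_space show ?thesis
  proof eventually_elim
    case (elim x)
    show ?case
    proof (rule ccontr)
      assume *: "\<not> f x \<le> g x"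
      then have "x \<in> A" using elim by (simp add: A_def)
      then have "f x - g x = 0" using elim by simp
      then show False using * by (simp add: diff_eq_0_iff_ennreal)
    qed
  qed
qed

text \<open>Running maxima of an enumeration. They turn a union over all rationals below a threshold
  into an increasing union, to which continuity from below applies.\<close>

lemma countable_incseq_cofinal:
  fixes D :: "'a::linorder set"
  assumes "countable D" "D \<noteq> {}"
  obtains m :: "nat \<Rightarrow> 'a" where "incseq m" "range m \<subseteq> D" "\<And>q. q \<in> D \<Longrightarrow> \<exists>n. q \<le> m n"
proof -
  define m where "m n = Max (from_nat_into D ` {..n})" for n
  have "m n \<in> D" for n
  proof -
    have "m n \<in> from_nat_into D ` {..n}" unfolding m_def by (intro Max_in) auto
    then show ?thesis using from_nat_into[OF assms(2)] by auto
  qed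
  moreover have "incseq m" unfolding m_def incseq_def by (intro allI impI Max_mono) auto
  moreover have "\<exists>n. q \<le> m n" if q: "q \<in> D" for q
  proof -
    obtain n where "from_nat_into D n = q" using from_nat_into_surj[OF assms(1) q] by blast
    then show ?thesis unfolding m_def by (intro exI[of _ n] Max_ge) auto
  qed
  ultimately show thesis using that by blast
qed

text \<open>Negative \<open>u\<close> also belong to the set, since \<open>ennreal\<close> sends
  them to 0, but the uniform law does not charge them. What remains is an initial segment of the
  unit interval of length \<open>c\<close>.\<close>

lemma emeasure_uniform_unit_interval_le:
  assumes "c \<le> 1"
  shows "emeasure (uniform_measure lborel {0..1::real}) {u. ennreal u \<le> c} = c"
proof -
  from assms have "c \<noteq> \<infinity>" by (auto simp: top_unique)
  then obtain d where d: "c = ennreal d" "0 \<le> d" by (cases c) auto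
  with assms have "d \<le> 1" by simp
  then have "{0..1} \<inter> {u. ennreal u \<le> c} = {0..d}" using d by (auto simp: ennreal_le_iff)
  moreover have "{u. ennreal u \<le> c} \<in> sets borel" by measurable
  ultimately show ?thesis using d by (simp add: divide_ennreal_def)
qed

text \<open>
  Conditional probabilities \<open>F q\<close> of \<open>V \<le> q\<close> are needed for rational \<open>q\<close> only, and almost surely
  monotone versions suffice: the event \<open>Q < r\<close> is the union of the events \<open>u \<le> F q\<close> over rational
  \<open>q < r\<close>, so neither right-continuity nor a regular conditional distribution enters.
\<close>

lemma quantile_coupling:
  fixes V :: "'a \<Rightarrow> real"
  assumes "prob_space P" and V[measurable]: "V \<in> borel_measurable P" and Z[measurable]: "Z \<in> P \<rightarrow>\<^sub>M N"
    and bd: "\<And>\<omega>. \<omega> \<in> space P \<Longrightarrow> \<bar>V \<omega>\<bar> \<le> K"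
  obtains Q where "Q \<in> borel_measurable (uniform_measure lborel {0..1::real} \<Otimes>\<^sub>M N)"
    "distr (uniform_measure lborel {0..1} \<Otimes>\<^sub>M distr P N Z) (borel \<Otimes>\<^sub>M N) (\<lambda>p. (Q p, snd p)) =
     distr P (borel \<Otimes>\<^sub>M N) (\<lambda>\<omega>. (V \<omega>, Z \<omega>))"
proof -
  interpret P: prob_space P by fact
  define U where "U = uniform_measure lborel {0..1::real}"
  interpret U: prob_space U unfolding U_def by (rule prob_space_uniform_measure) auto
  define \<nu> where "\<nu> = distr P N Z"
  interpret \<nu>: prob_space \<nu> unfolding \<nu>_def by (rule P.prob_space_distr) measurable
  interpret UN: pair_sigma_finite U \<nu> ..
  have [measurable_cong, simp]: "sets \<nu> = sets N" "sets U = sets borel" by (auto simp: \<nu>_def U_def)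
  have sp[simp]: "space U = UNIV" "space \<nu> = space N" by (auto simp: \<nu>_def U_def)
  have V_ge: "- K \<le> V \<omega>" if "\<omega> \<in> space P" for \<omega> using bd[OF that] by simp
  have K0: "0 \<le> K" using bd P.not_empty by force

  \<comment> \<open>The law of \<open>Z\<close> restricted to the event \<open>V \<le> q\<close>.
    Its density \<open>F q\<close> with respect to \<open>\<nu>\<close> is a version of the
    conditional probability of \<open>V \<le> q\<close> given \<open>Z\<close>.\<close>
  define \<nu>q where "\<nu>q q = distr (density P (indicator {\<omega>. V \<omega> \<le> q})) N Z" for q
  have \<nu>q: "emeasure (\<nu>q q) B = emeasure P {\<omega> \<in> space P. V \<omega> \<le> q \<and> Z \<omega> \<in> B}" if [measurable]: "B \<in> sets N" for q B
  proof -
    have "emeasure (\<nu>q q) B = (\<integral>\<^sup>+\<omega>. indicator {\<omega>. V \<omega> \<le> q} \<omega> * indicator (Z -` B \<inter> space P) \<omega> \<partial>P)"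
      by (simp add: \<nu>q_def emeasure_distr emeasure_density)
    also have "\<dots> = (\<integral>\<^sup>+\<omega>. indicator {\<omega> \<in> space P. V \<omega> \<le> q \<and> Z \<omega> \<in> B} \<omega> \<partial>P)"
      by (intro nn_integral_cong) (auto simp: indicator_def)
    finally show ?thesis by simp
  qed
  have \<nu>_eq: "emeasure \<nu> B = emeasure P {\<omega> \<in> space P. Z \<omega> \<in> B}" if "B \<in> sets N" for B
    using that by (simp add: \<nu>_def emeasure_distr vimage_def Int_def conj_commute)
  define F where "F q = RN_deriv \<nu> (\<nu>q q)" for q
  have [measurable]: "F q \<in> borel_measurable N" for q
    unfolding F_def using borel_measurable_RN_deriv[of \<nu> "\<nu>q q"] by simp
  have F: "(\<integral>\<^sup>+z\<in>B. F q z \<partial>\<nu>) = emeasure P {\<omega> \<in> space P. V \<omega> \<le> q \<and> Z \<omega> \<in> B}" if [measurable]: "B \<in> sets N" for q B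
  proof -
    have "absolutely_continuous \<nu> (\<nu>q q)"
      unfolding absolutely_continuous_def
    proof
      fix B assume "B \<in> null_sets \<nu>"
      then have B: "B \<in> sets N" "emeasure P {\<omega> \<in> space P. Z \<omega> \<in> B} = 0" by (auto simp: null_sets_def \<nu>_eq)
      have "emeasure P {\<omega> \<in> space P. V \<omega> \<le> q \<and> Z \<omega> \<in> B} \<le> emeasure P {\<omega> \<in> space P. Z \<omega> \<in> B}"
        using B(1) by (intro emeasure_mono) auto
      with B show "B \<in> null_sets (\<nu>q q)" by (auto simp: null_sets_def \<nu>q) (simp add: \<nu>q_def)
    qed
    then have "density \<nu> (F q) = \<nu>q q"
      unfolding F_def by (rule \<nu>.density_RN_deriv) (simp add: \<nu>q_def)
    then have "emeasure (density \<nu> (F q)) B = emeasure (\<nu>q q) B" by simp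
    then show ?thesis by (simp add: emeasure_density \<nu>q)
  qed
  have F_fin: "(\<integral>\<^sup>+z. F q z \<partial>\<nu>) \<noteq> \<infinity>" for q
  proof -
    have "(\<integral>\<^sup>+z. F q z \<partial>\<nu>) = (\<integral>\<^sup>+z\<in>space N. F q z \<partial>\<nu>)" by (intro nn_integral_cong) simp
    then show ?thesis by (simp add: F)
  qed
  have F_mono: "AE z in \<nu>. F q z \<le> F q' z" if "q \<le> q'" for q q'
    by (rule AE_le_of_set_nn_integral_le) (use that F_fin in \<open>auto simp: F intro!: emeasure_mono\<close>)
  have F_le1: "AE z in \<nu>. F q z \<le> 1" for q
    by (rule AE_le_of_set_nn_integral_le) (use F_fin in \<open>auto simp: F \<nu>_eq intro!: emeasure_mono\<close>)

  define D where "D = \<rat> \<inter> {-K..K}"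
  have D: "countable D" "0 \<in> D" "D \<subseteq> {-K..K}"
    using countable_rat K0 by (auto simp: D_def intro: countable_Int1)
  \<comment> \<open>Each comparison has its own exceptional null set; countability of
    \<open>D\<close> merges them into one.\<close>
  have F_good: "AE z in \<nu>. \<forall>q\<in>D. F q z \<le> 1 \<and> (\<forall>q'\<in>D. q \<le> q' \<longrightarrow> F q z \<le> F q' z)"
    using F_le1 F_mono D(1) by (auto simp: AE_ball_countable)
  \<comment> \<open>The generalized inverse of \<open>F\<close> in its index: the least
    \<open>q\<close> with \<open>u \<le> F q z\<close>. An index that fails the test contributes the
    default \<open>K\<close>, an upper bound of \<open>D\<close>. So the infimum runs over a fixed
    countable nonempty set, which gives measurability, and the default shows only in thresholds
    above \<open>K\<close>.\<close>
  define Q where "Q p = (INF q\<in>D. if ennreal (fst p) \<le> F q (snd p) then q else K)" for p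
  have Q_meas[measurable]: "Q \<in> borel_measurable (borel \<Otimes>\<^sub>M N)"
    unfolding Q_def using D(1) by measurable
  have Q_bdd: "bdd_below ((\<lambda>q. if ennreal u \<le> F q z then q else K) ` D)" for u z
    using D(3) K0 by (intro bdd_belowI[of _ "-K"]) auto
  have Q_less: "Q (u, z) < r \<longleftrightarrow> K < r \<or> (\<exists>q\<in>D. q < r \<and> ennreal u \<le> F q z)" for u z r
  proof -
    have "Q (u, z) < r \<longleftrightarrow> (\<exists>q\<in>D. (if ennreal u \<le> F q z then q else K) < r)"
      unfolding Q_def using D(2) Q_bdd by (subst cINF_less_iff) auto
    then show ?thesis using D(2,3) by (fastforce split: if_splits)
  qed
  have rat: "\<exists>q\<in>D. v \<le> q \<and> q < r" if v: "-K \<le> v" "v < r" "r \<le> K" for v r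
  proof -
    obtain q where "q \<in> \<rat>" "v < q" "q < r" using Rats_dense_in_real[OF v(2)] by blast
    with v show ?thesis by (intro bexI[of _ q]) (auto simp: D_def)
  qed

  \<comment> \<open>For \<open>K < r\<close> both sides are the \<open>\<nu>\<close>-mass of
    \<open>B\<close>. If no element of \<open>D\<close> lies below \<open>r \<le> K\<close>, both
    vanish. Otherwise the event is sliced at fixed \<open>z\<close> and exhausted along rationals
    \<open>m n\<close> increasing towards \<open>r\<close>.\<close>
  have key: "emeasure (U \<Otimes>\<^sub>M \<nu>) {p \<in> space (borel \<Otimes>\<^sub>M N). Q p < r \<and> snd p \<in> B} =
      emeasure P {\<omega> \<in> space P. V \<omega> < r \<and> Z \<omega> \<in> B}" if [measurable]: "B \<in> sets N" for r B
  proof (cases "K < r")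
    case True
    then have "{p \<in> space (borel \<Otimes>\<^sub>M N). Q p < r \<and> snd p \<in> B} = space U \<times> B"
      using Q_less sets.sets_into_space[OF that] by (auto simp: space_pair_measure)
    moreover have "{\<omega> \<in> space P. V \<omega> < r \<and> Z \<omega> \<in> B} = {\<omega> \<in> space P. Z \<omega> \<in> B}"
      using True bd by force
    ultimately show ?thesis
      using U.emeasure_space_1 by (simp add: \<nu>.emeasure_pair_measure_Times \<nu>_eq)
  next
    case False
    define Dr where "Dr = {q \<in> D. q < r}"
    show ?thesis
    proof (cases "Dr = {}")
      case True
      then have 1: "{p \<in> space (borel \<Otimes>\<^sub>M N). Q p < r \<and> snd p \<in> B} = {}"
        using False Q_less by (auto simp: Dr_def)
      have 2: "{\<omega> \<in> space P. V \<omega> < r \<and> Z \<omega> \<in> B} = {}"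
      proof -
        have "\<not> V \<omega> < r" if "\<omega> \<in> space P" for \<omega>
          using rat[of "V \<omega>" r] V_ge[OF that] False True by (auto simp: Dr_def)
        then show ?thesis by auto
      qed
      show ?thesis unfolding 1 2 by simp
    next
      case ne: False
      have "countable Dr" using D(1) by (simp add: Dr_def)
      from countable_incseq_cofinal[OF this ne] obtain m where
        m: "incseq m" "range m \<subseteq> Dr" "\<And>q. q \<in> Dr \<Longrightarrow> \<exists>n. q \<le> m n" by metis
      have mD: "m n \<in> D" "m n < r" for n using m(2) by (auto simp: Dr_def)
      have "emeasure (U \<Otimes>\<^sub>M \<nu>) {p \<in> space (borel \<Otimes>\<^sub>M N). Q p < r \<and> snd p \<in> B} =
          (\<integral>\<^sup>+z. emeasure U ((\<lambda>u. (u, z)) -` {p \<in> space (borel \<Otimes>\<^sub>M N). Q p < r \<and> snd p \<in> B}) \<partial>\<nu>)"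
        by (rule UN.emeasure_pair_measure_alt2) measurable
      \<comment> \<open>At almost every \<open>z\<close> in \<open>B\<close> the slice is the
        increasing union of the events \<open>u \<le> F (m n) z\<close>, whose uniform probability
        is \<open>F (m n) z\<close>.\<close>
      also have "\<dots> = (\<integral>\<^sup>+z. (SUP n. F (m n) z * indicator B z) \<partial>\<nu>)"
      proof (rule nn_integral_cong_AE, use F_good AE_space in eventually_elim)
        case (elim z)
        show ?case
        proof (cases "z \<in> B")
          case True
          have "(\<lambda>u. (u, z)) -` {p \<in> space (borel \<Otimes>\<^sub>M N). Q p < r \<and> snd p \<in> B} = {u. Q (u, z) < r}"
            using True elim by (auto simp: space_pair_measure)
          also have "\<dots> = (\<Union>n. {u. ennreal u \<le> F (m n) z})"
          proof safe
            fix u assume "Q (u, z) < r"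
            then obtain q where q: "q \<in> Dr" "ennreal u \<le> F q z" using False by (auto simp: Q_less Dr_def)
            then obtain n where "q \<le> m n" using m(3) by blast
            then have "F q z \<le> F (m n) z" using elim q mD by (auto simp: Dr_def)
            with q show "u \<in> (\<Union>n. {u. ennreal u \<le> F (m n) z})" by (auto intro: order_trans)
          qed (use mD in \<open>auto simp: Q_less\<close>)
          finally have "emeasure U ((\<lambda>u. (u, z)) -` {p \<in> space (borel \<Otimes>\<^sub>M N). Q p < r \<and> snd p \<in> B}) =
              emeasure U (\<Union>n. {u. ennreal u \<le> F (m n) z})" by simp
          also have "\<dots> = (SUP n. emeasure U {u. ennreal u \<le> F (m n) z})"
          proof (rule SUP_emeasure_incseq[symmetric])
            show "incseq (\<lambda>n. {u. ennreal u \<le> F (m n) z})"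
              using elim mD m(1) by (auto simp: incseq_def intro: order_trans)
          qed auto
          also have "\<dots> = (SUP n. F (m n) z)"
            using elim mD unfolding U_def by (simp add: emeasure_uniform_unit_interval_le del: emeasure_uniform_measure)
          finally show ?thesis using True by simp
        qed simp
      qed
      also have "\<dots> = (SUP n. \<integral>\<^sup>+z. F (m n) z * indicator B z \<partial>\<nu>)"
      proof (rule nn_integral_monotone_convergence_SUP_AE)
        show "AE z in \<nu>. F (m n) z * indicator B z \<le> F (m (Suc n)) z * indicator B z" for n
          using F_mono[of "m n" "m (Suc n)"] m(1)
          by (auto simp: incseq_SucD intro: mult_right_mono elim!: eventually_mono)
      qed simp
      also have "\<dots> = (SUP n. emeasure P {\<omega> \<in> space P. V \<omega> \<le> m n \<and> Z \<omega> \<in> B})"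
        by (simp add: F)
      also have "\<dots> = emeasure P (\<Union>n. {\<omega> \<in> space P. V \<omega> \<le> m n \<and> Z \<omega> \<in> B})"
        by (rule SUP_emeasure_incseq) (use m(1) in \<open>force simp: incseq_def\<close>)+
      also have "(\<Union>n. {\<omega> \<in> space P. V \<omega> \<le> m n \<and> Z \<omega> \<in> B}) = {\<omega> \<in> space P. V \<omega> < r \<and> Z \<omega> \<in> B}"
      proof safe
        fix \<omega> assume \<omega>: "\<omega> \<in> space P" "V \<omega> < r" "Z \<omega> \<in> B"
        then obtain q where "q \<in> Dr" "V \<omega> \<le> q" using rat[of "V \<omega>" r] V_ge[of \<omega>] False by (force simp: Dr_def)
        moreover obtain n where "q \<le> m n" using m(3) calculation by blast
        ultimately have "V \<omega> \<le> m n" by linarith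
        with \<omega> show "\<omega> \<in> (\<Union>n. {\<omega> \<in> space P. V \<omega> \<le> m n \<and> Z \<omega> \<in> B})" by blast
      qed (use mD in \<open>auto intro: le_less_trans\<close>)
      finally show ?thesis .
    qed
  qed

  let ?L = "distr (U \<Otimes>\<^sub>M \<nu>) (borel \<Otimes>\<^sub>M N) (\<lambda>p. (Q p, snd p))"
  let ?R = "distr P (borel \<Otimes>\<^sub>M N) (\<lambda>\<omega>. (V \<omega>, Z \<omega>))"
  let ?E = "{a \<times> b | a b. a \<in> range (lessThan :: real \<Rightarrow> _) \<and> b \<in> sets N}"
  have [measurable]: "Q \<in> borel_measurable (U \<Otimes>\<^sub>M \<nu>)"
    by measurable
  have sets_eq: "sets ((borel :: real measure) \<Otimes>\<^sub>M N) = sigma_sets (UNIV \<times> space N) ?E"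
  proof -
    have "sets ((borel :: real measure) \<Otimes>\<^sub>M N) = sets (sigma (space borel \<times> space N) ?E)"
    proof (rule sets_pair_eq)
      show "sets (borel::real measure) = sigma_sets (space borel) (range lessThan)"
        by (subst borel_eq_lessThan) (simp add: eucl_lessThan)
      show "sets N = sigma_sets (space N) (sets N)" by (simp add: sets.sigma_sets_eq)
      show "countable (range (\<lambda>n::nat. {..<real n}))" "countable {space N}" by auto
      show "\<Union> (range (\<lambda>n::nat. {..<real n})) = space borel" using reals_Archimedean2 by auto
    qed (auto simp: sets.space_closed)
    also have "\<dots> = sigma_sets (UNIV \<times> space N) ?E"
      using sets.sets_into_space unfolding space_borel by (intro sets_measure_of) blast
    finally show ?thesis .
  qed
  \<comment> \<open>Rectangles with an open half-line as first side form an intersection-stable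
    generator on which \<open>key\<close> equates both laws; the rectangles
    \<open>{..<real n} \<times> space N\<close> cover the space with finite mass.\<close>
  have "?L = ?R"
  proof (rule measure_eqI_generator_eq[where E="?E" and \<Omega>="UNIV \<times> space N" and A="\<lambda>n. {..<real n} \<times> space N"])
    show "Int_stable ?E"
    proof (rule Int_stableI)
      fix A B assume "A \<in> ?E" "B \<in> ?E"
      then obtain r s :: real and a b where *: "A = {..<r} \<times> a" "B = {..<s} \<times> b" "a \<in> sets N" "b \<in> sets N" by auto
      then have "A \<inter> B = {..<min r s} \<times> (a \<inter> b)" by auto
      with * show "A \<inter> B \<in> ?E" by auto
    qed
    show "?E \<subseteq> Pow (UNIV \<times> space N)" using sets.sets_into_space by blast
    fix X assume "X \<in> ?E"
    then obtain r B where X: "X = {..<r} \<times> B" and B[measurable]: "B \<in> sets N" by auto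
    have "emeasure ?L X = emeasure (U \<Otimes>\<^sub>M \<nu>) {p \<in> space (borel \<Otimes>\<^sub>M N). Q p < r \<and> snd p \<in> B}"
      unfolding X by (subst emeasure_distr) (auto simp: space_pair_measure intro!: arg_cong2[where f=emeasure])
    also have "\<dots> = emeasure ?R X"
      unfolding X key[OF B] by (subst emeasure_distr) (auto intro!: arg_cong2[where f=emeasure])
    finally show "emeasure ?L X = emeasure ?R X" .
  next
    show "(\<Union>n. {..<real n} \<times> space N) = UNIV \<times> space N" using reals_Archimedean2 by auto
    have "prob_space ?L"
      by (rule prob_space.prob_space_distr) (auto intro: prob_space_pair U.prob_space_axioms \<nu>.prob_space_axioms)
    then interpret L: prob_space ?L .
    show "emeasure ?L ({..<real n} \<times> space N) \<noteq> \<infinity>" for n by simp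
  qed (auto simp: sets_eq)
  moreover have "Q \<in> borel_measurable (U \<Otimes>\<^sub>M N)" by measurable
  ultimately show thesis using that[of Q] unfolding U_def \<nu>_def by simp
qed

subsection \<open>Structural models\<close>

text \<open>The hypothesis makes \<open>h (Z \<omega>)\<close> a conditional probability of the
  event \<open>U \<in> A\<close> given \<open>V\<close> and \<open>Z\<close> jointly. As it depends
  on \<open>Z\<close> alone, it factors out when conditioning on \<open>Z\<close> only, which yields
  the product formula.\<close>

lemma cond_indep_varI_kernel:
  assumes "prob_space M"
    and [measurable]: "U \<in> M \<rightarrow>\<^sub>M N\<^sub>U" "V \<in> M \<rightarrow>\<^sub>M N\<^sub>V" "Z \<in> M \<rightarrow>\<^sub>M N\<^sub>Z"
    and kernel: "\<And>A. A \<in> sets N\<^sub>U \<Longrightarrow> \<exists>h \<in> borel_measurable N\<^sub>Z. (\<forall>z \<in> space N\<^sub>Z. \<bar>h z\<bar> \<le> 1) \<and>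
      (\<forall>B \<in> sets N\<^sub>V. \<forall>C \<in> sets N\<^sub>Z.
        (\<integral>\<omega>. indicator A (U \<omega>) * indicator B (V \<omega>) * indicator C (Z \<omega>) \<partial>M) =
        (\<integral>\<omega>. h (Z \<omega>) * indicator B (V \<omega>) * indicator C (Z \<omega>) \<partial>M :: real))"
  shows "cond_indep_var M N\<^sub>U U N\<^sub>V V N\<^sub>Z Z"
  unfolding cond_indep_var_def
proof (intro conjI ballI)
  fix A B assume A[measurable]: "A \<in> sets N\<^sub>U" and B[measurable]: "B \<in> sets N\<^sub>V"
  interpret prob_space M by fact
  define G where "G = vimage_algebra (space M) Z N\<^sub>Z"
  have ZG[measurable]: "Z \<in> G \<rightarrow>\<^sub>M N\<^sub>Z"
    unfolding G_def by (rule measurable_vimage_algebra1) (use measurable_space[OF assms(4)] in auto)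
  have "subalgebra M G"
    unfolding subalgebra_def G_def by (simp add: sets_image_in_sets)
  then interpret finite_measure_subalgebra M G
    by unfold_locales
  from kernel[OF A] obtain h where [measurable]: "h \<in> borel_measurable N\<^sub>Z"
    and h_bd: "\<And>z. z \<in> space N\<^sub>Z \<Longrightarrow> \<bar>h z\<bar> \<le> 1"
    and h: "\<And>B C. B \<in> sets N\<^sub>V \<Longrightarrow> C \<in> sets N\<^sub>Z \<Longrightarrow>
        (\<integral>\<omega>. indicator A (U \<omega>) * indicator B (V \<omega>) * indicator C (Z \<omega>) \<partial>M) =
        (\<integral>\<omega>. h (Z \<omega>) * indicator B (V \<omega>) * indicator C (Z \<omega>) \<partial>M :: real)"
    by blast
  have hZ_bd: "\<bar>h (Z \<omega>)\<bar> \<le> 1" if "\<omega> \<in> space M" for \<omega>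
    using h_bd measurable_space[OF assms(4) that] .
  \<comment> \<open>Tested on sets of \<open>G\<close>, all of them preimages under
    \<open>Z\<close>: there \<open>h (Z \<omega>)\<close> is a known bounded factor and can be
    pulled out of the conditional expectation.\<close>
  have step: "AE \<omega> in M. real_cond_exp M G (indicator (U -` A \<inter> V -` B \<inter> space M)) \<omega> =
      h (Z \<omega>) * real_cond_exp M G (indicator (V -` B \<inter> space M)) \<omega>"
    if [measurable]: "B \<in> sets N\<^sub>V" for B
  proof (rule real_cond_exp_charact)
    let ?e = "real_cond_exp M G (indicator (V -` B \<inter> space M))"
    have hB: "integrable M (\<lambda>\<omega>. f \<omega> * indicator (V -` B \<inter> space M) \<omega>)"
      if [measurable]: "f \<in> borel_measurable M" and "\<And>\<omega>. \<omega> \<in> space M \<Longrightarrow> \<bar>f \<omega>\<bar> \<le> 1" for f :: "_ \<Rightarrow> real"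
      by (rule integrable_const_bound[of _ 1]) (use that in \<open>auto simp: indicator_def\<close>)
    show "integrable M (\<lambda>\<omega>. h (Z \<omega>) * ?e \<omega>)"
      by (rule real_cond_exp_intg(1)) (auto intro!: hB hZ_bd)
    fix D assume D[measurable]: "D \<in> sets G"
    then obtain C where C[measurable]: "C \<in> sets N\<^sub>Z" and D_eq: "D = Z -` C \<inter> space M"
      unfolding G_def using measurable_space[OF assms(4)] by (subst (asm) sets_vimage_algebra2) auto
    have "(\<integral>\<omega>\<in>D. indicator (U -` A \<inter> V -` B \<inter> space M) \<omega> \<partial>M) =
        (\<integral>\<omega>. indicator A (U \<omega>) * indicator B (V \<omega>) * indicator C (Z \<omega>) \<partial>M :: real)"
      unfolding set_lebesgue_integral_def
      by (rule Bochner_Integration.integral_cong) (auto simp: D_eq indicator_def)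
    also have "\<dots> = (\<integral>\<omega>. h (Z \<omega>) * indicator B (V \<omega>) * indicator C (Z \<omega>) \<partial>M)" by (rule h) fact+
    also have "\<dots> = (\<integral>\<omega>. (indicator C (Z \<omega>) * h (Z \<omega>)) * indicator (V -` B \<inter> space M) \<omega> \<partial>M)"
      by (rule Bochner_Integration.integral_cong) (auto simp: indicator_def)
    also have "\<dots> = (\<integral>\<omega>. (indicator C (Z \<omega>) * h (Z \<omega>)) * ?e \<omega> \<partial>M)"
    proof (rule real_cond_exp_intg(2)[symmetric])
      show "integrable M (\<lambda>\<omega>. (indicator C (Z \<omega>) * h (Z \<omega>)) * indicator (V -` B \<inter> space M) \<omega>)"
        by (rule hB) (use hZ_bd in \<open>auto simp: indicator_def\<close>)
    qed auto
    also have "\<dots> = (\<integral>\<omega>\<in>D. h (Z \<omega>) * ?e \<omega> \<partial>M)"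
      unfolding set_lebesgue_integral_def
      by (rule Bochner_Integration.integral_cong) (auto simp: D_eq indicator_def)
    finally show "(\<integral>\<omega>\<in>D. indicator (U -` A \<inter> V -` B \<inter> space M) \<omega> \<partial>M) =
        (\<integral>\<omega>\<in>D. h (Z \<omega>) * ?e \<omega> \<partial>M)" .
  next
    show "integrable M (indicator (U -` A \<inter> V -` B \<inter> space M) :: _ \<Rightarrow> real)"
    proof (rule integrable_real_indicator)
      have "U -` A \<inter> V -` B \<inter> space M = (U -` A \<inter> space M) \<inter> (V -` B \<inter> space M)" by auto
      then show "U -` A \<inter> V -` B \<inter> space M \<in> sets M" by simp
    qed (simp add: less_top[symmetric])
  qed auto
  \<comment> \<open>Taking the whole space for \<open>B\<close> in \<open>step\<close> identifies
    \<open>h (Z \<omega>)\<close> as the conditional probability of \<open>U \<in> A\<close> given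
    \<open>Z\<close>.\<close>
  have "V -` space N\<^sub>V \<inter> space M = space M" using measurable_space[OF assms(3)] by auto
  moreover have "AE \<omega> in M. real_cond_exp M G (indicator (space M)) \<omega> = 1"
  proof -
    have "AE \<omega> in M. real_cond_exp M G (indicator (space M)) \<omega> = indicator (space M) \<omega>"
    proof (rule real_cond_exp_F_meas)
      have "space M = space G" by (simp add: G_def)
      then show "indicator (space M) \<in> borel_measurable G" by auto
      show "integrable M (indicator (space M) :: _ \<Rightarrow> real)"
        by (rule integrable_real_indicator) (auto simp: less_top[symmetric])
    qed
    with AE_space show ?thesis by eventually_elim auto
  qed
  ultimately have "AE \<omega> in M. real_cond_exp M G (indicator (U -` A \<inter> space M)) \<omega> = h (Z \<omega>)"
    using step[OF sets.top] by (auto simp: Int_assoc elim!: eventually_elim2)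
  with step[OF B] show "AE \<omega> in M. real_cond_exp M (vimage_algebra (space M) Z N\<^sub>Z)
          (indicator (U -` A \<inter> V -` B \<inter> space M)) \<omega> =
        real_cond_exp M (vimage_algebra (space M) Z N\<^sub>Z) (indicator (U -` A \<inter> space M)) \<omega> *
        real_cond_exp M (vimage_algebra (space M) Z N\<^sub>Z) (indicator (V -` B \<inter> space M)) \<omega>"
    unfolding G_def[symmetric] by eventually_elim simp
qed measurable

section \<open>Measurability on the space of potential outcomes\<close>

lemma space_structural_product:
  "space (structural_product Y T X) = (T \<rightarrow>\<^sub>E Y) \<times> T \<times> X"
  by (auto simp: structural_product_def space_pair_measure space_PiM space_restrict_space)

lemma structural_space_generator_subset:
  "sets (structural_product Y T X) \<union>
     sets (vimage_algebra (space (structural_product Y T X)) observe borel)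
   \<subseteq> Pow (space (structural_product Y T X))"
  using sets.space_closed[of "structural_product Y T X"]
    sets.space_closed[of "vimage_algebra (space (structural_product Y T X)) observe borel"] by simp

lemma space_structural_space:
  "space (structural_space Y T X) = (T \<rightarrow>\<^sub>E Y) \<times> T \<times> X"
  unfolding structural_space_def space_measure_of[OF structural_space_generator_subset]
  by (rule space_structural_product)

text \<open>Measurability into a generated \<open>\<sigma>\<close>-algebra is decided on generators,
  which here are product events and events in the observables.\<close>

lemma measurable_structural_spaceI:
  assumes "f \<in> M \<rightarrow>\<^sub>M structural_product Y T X" and "(\<lambda>\<omega>. observe (f \<omega>)) \<in> borel_measurable M"
  shows "f \<in> M \<rightarrow>\<^sub>M structural_space Y T X"
  unfolding structural_space_def
proof (rule measurable_measure_of)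
  let ?S = "structural_product Y T X"
  show "sets ?S \<union> sets (vimage_algebra (space ?S) observe borel) \<subseteq> Pow (space ?S)"
    by (rule structural_space_generator_subset)
  show f: "f \<in> space M \<rightarrow> space ?S" using measurable_space[OF assms(1)] by auto
  fix A assume "A \<in> sets ?S \<union> sets (vimage_algebra (space ?S) observe borel)"
  then show "f -` A \<inter> space M \<in> sets M"
    using assms measurable_vimage_algebra2[OF f] by (blast intro: measurable_sets)
qed

lemma measurable_id_structural_product:
  "(\<lambda>\<omega>. \<omega>) \<in> structural_space Y T X \<rightarrow>\<^sub>M structural_product Y T X"
  and measurable_observe:
  "observe \<in> structural_space Y T X \<rightarrow>\<^sub>M restrict_space borel (Y \<times> T \<times> X)"
proof -
  let ?S = "structural_product Y T X"
  have sp: "space (structural_space Y T X) = space ?S"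
    by (simp add: space_structural_space space_structural_product)
  have sets: "A \<in> sets (structural_space Y T X)"
    if "A \<in> sets ?S \<union> sets (vimage_algebra (space ?S) observe borel)" for A
    unfolding structural_space_def using that by (subst sets_measure_of[OF structural_space_generator_subset]) (rule sigma_sets.Basic)
  show "(\<lambda>\<omega>. \<omega>) \<in> structural_space Y T X \<rightarrow>\<^sub>M ?S"
  proof (rule measurableI)
    fix A assume "A \<in> sets ?S"
    moreover from this have "A \<subseteq> space ?S" by (rule sets.sets_into_space)
    ultimately show "(\<lambda>\<omega>. \<omega>) -` A \<inter> space (structural_space Y T X) \<in> sets (structural_space Y T X)"
      using sets by (simp add: sp Int_absorb2)
  qed (simp add: sp)
  have "observe \<in> borel_measurable (structural_space Y T X)"
    by (rule measurableI) (auto simp: sp intro!: sets in_vimage_algebra)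
  then show "observe \<in> structural_space Y T X \<rightarrow>\<^sub>M restrict_space borel (Y \<times> T \<times> X)"
    by (rule measurable_restrict_space2[rotated])
       (auto simp: space_structural_space observe_def)
qed

section \<open>The distributions induced by the unconfounded model\<close>

lemma model_UC_subset: "model_UC Y T X \<subseteq> prob_measures (Y \<times> T \<times> X)"
  unfolding model_UC_def
proof safe
  fix P assume "P \<in> structural_UC Y T X"
  then have "prob_space P" "sets P = sets (structural_space Y T X)" by (auto simp: structural_UC_def)
  moreover from this(2) have "observe \<in> P \<rightarrow>\<^sub>M restrict_space borel (Y \<times> T \<times> X)"
    using measurable_observe by (simp cong: measurable_cong_sets)
  ultimately show "distr P (restrict_space borel (Y \<times> T \<times> X)) observe \<in> prob_measures (Y \<times> T \<times> X)"
    by (simp add: prob_measures_def prob_space.prob_space_distr)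
qed

text \<open>The witness is the law \<open>S\<close> of \<open>\<phi>\<close> under a uniform
  \<open>U\<close> and an independent pair with the treatment and covariate law of \<open>P\<close>.
  Boundedness of \<open>Y\<close> feeds the quantile coupling; that \<open>Y\<close> is Borel allows
  the quantile function to be corrected to take values in \<open>Y\<close>.\<close>

lemma prob_measures_subset_model_UC:
  fixes Y :: "real set" and T :: "'t::euclidean_space set" and X :: "'x::euclidean_space set"
  assumes Y: "Y \<in> sets borel" "bounded Y" and T: "T \<in> sets borel" and X: "X \<in> sets borel"
  shows "prob_measures (Y \<times> T \<times> X) \<subseteq> model_UC Y T X"
proof
  fix P assume "P \<in> prob_measures (Y \<times> T \<times> X)"
  then interpret P: prob_space P by (simp add: prob_measures_def)
  let ?W = "Y \<times> T \<times> X"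
  have sets_P: "sets P = sets (restrict_space borel ?W)"
    using \<open>P \<in> _\<close> by (simp add: prob_measures_def)
  have space_P: "space P = ?W"
    using sets_eq_imp_space_eq[OF sets_P] by (simp add: space_restrict_space)
  then obtain y0 where y0: "y0 \<in> Y" using P.not_empty by auto
  obtain K where K: "\<And>y. y \<in> Y \<Longrightarrow> \<bar>y\<bar> \<le> K" using Y(2) by (auto simp: bounded_iff)
  define N where "N = restrict_space borel T \<Otimes>\<^sub>M restrict_space borel X"
  have space_N: "space N = T \<times> X" by (simp add: N_def space_pair_measure space_restrict_space)
  have id_P: "(\<lambda>w. w) \<in> P \<rightarrow>\<^sub>M borel"
    by (subst measurable_cong_sets[OF sets_P refl]) (simp add: measurable_restrict_space1)
  then have P_borel: "fst \<in> borel_measurable P" "(\<lambda>w. fst (snd w)) \<in> borel_measurable P"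
      "(\<lambda>w. snd (snd w)) \<in> borel_measurable P"
    by (simp_all flip: borel_prod)
  have snd_P: "snd \<in> P \<rightarrow>\<^sub>M N"
    unfolding N_def
    by (rule measurable_pair; rule measurable_restrict_space2)
       (use P_borel in \<open>auto simp: space_P comp_def\<close>)
  let ?U = "uniform_measure lborel {0..1::real}"
  define \<nu> where "\<nu> = distr P N snd"
  obtain Q where Q[measurable]: "Q \<in> borel_measurable (?U \<Otimes>\<^sub>M N)"
    and Q_coupling: "distr (?U \<Otimes>\<^sub>M \<nu>) (borel \<Otimes>\<^sub>M N) (\<lambda>p. (Q p, snd p)) = distr P (borel \<Otimes>\<^sub>M N) (\<lambda>w. (fst w, snd w))"
    unfolding \<nu>_def using K by (rule quantile_coupling[OF P.prob_space_axioms P_borel(1) snd_P]) (auto simp: space_P)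
  then have Q_law: "distr (?U \<Otimes>\<^sub>M \<nu>) (borel \<Otimes>\<^sub>M N) (\<lambda>p. (Q p, snd p)) = distr P (borel \<Otimes>\<^sub>M N) (\<lambda>w. w)"
    by simp
  have id_BN: "(\<lambda>w. w) \<in> P \<rightarrow>\<^sub>M borel \<Otimes>\<^sub>M N"
    using measurable_Pair[OF P_borel(1) snd_P] by simp
  interpret U: prob_space ?U by (rule prob_space_uniform_measure) auto
  interpret \<nu>: prob_space \<nu> unfolding \<nu>_def by (rule P.prob_space_distr) fact
  interpret UN: pair_prob_space ?U \<nu> ..
  have sets_\<nu>[measurable_cong, simp]: "sets \<nu> = sets N" and space_\<nu>: "space \<nu> = space N" by (auto simp: \<nu>_def)
  \<comment> \<open>changes \<open>Q\<close> on a null set only, so that every path \<open>t \<mapsto> Q' (u, t, x)\<close> stays in \<open>Y\<close>\<close>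
  define Q' where "Q' p = (if Q p \<in> Y then Q p else y0)" for p
  have [measurable]: "Y \<in> sets borel" by fact
  have Q'_borel[measurable]: "Q' \<in> borel_measurable (?U \<Otimes>\<^sub>M N)" unfolding Q'_def by measurable
  have Q'_Y: "Q' p \<in> Y" for p using y0 by (simp add: Q'_def)
  have Q'_meas[measurable]: "Q' \<in> ?U \<Otimes>\<^sub>M N \<rightarrow>\<^sub>M restrict_space borel Y"
    by (rule measurable_restrict_space2) (use Q'_Y in auto)
  \<comment> \<open>Under \<open>P\<close> the outcome always lies in \<open>Y\<close>, and the
    coupling transfers this to \<open>Q\<close> almost surely.\<close>
  have Q'_eq: "AE p in ?U \<Otimes>\<^sub>M \<nu>. Q' p = Q p"
  proof -
    have "AE q in distr P (borel \<Otimes>\<^sub>M N) (\<lambda>w. w). fst q \<in> Y"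
      using id_BN by (subst AE_distr_iff) (auto simp: space_P)
    then have "AE p in ?U \<Otimes>\<^sub>M \<nu>. Q p \<in> Y"
      unfolding Q_law[symmetric] by (subst (asm) AE_distr_iff) auto
    then show ?thesis by eventually_elim (simp add: Q'_def)
  qed

  \<comment> \<open>The path inserts every \<open>t\<close> in place of the realized treatment and
    keeps only \<open>u\<close> and the covariates; this is the source of unconfoundedness. It is
    restricted to \<open>T\<close> because points of the product space are extensional
    functions.\<close>
  define \<phi> where "\<phi> p = ((\<lambda>t\<in>T. Q' (fst p, t, snd (snd p))), snd p)" for p :: "real \<times> 't \<times> 'x"
  have obs_\<phi>: "observe (\<phi> p) = (Q' p, snd p)" if "p \<in> space (?U \<Otimes>\<^sub>M N)" for p
    using that by (cases p) (auto simp: observe_def \<phi>_def space_pair_measure space_N)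
  have pair_N: "(\<lambda>p. (fst p, t, snd (snd p))) \<in> ?U \<Otimes>\<^sub>M N \<rightarrow>\<^sub>M ?U \<Otimes>\<^sub>M N" if "t \<in> T" for t
    unfolding N_def using that by (auto simp: space_restrict_space)
  have into_borel: "(\<lambda>p. (f p, snd p)) \<in> M \<rightarrow>\<^sub>M borel"
    if f[measurable]: "f \<in> borel_measurable M" and [measurable]: "snd \<in> M \<rightarrow>\<^sub>M N" for f :: "real \<times> 't \<times> 'x \<Rightarrow> real" and M
  proof -
    have [measurable]: "fst \<in> borel_measurable N" "snd \<in> borel_measurable N"
      unfolding N_def by (auto intro!: measurable_compose[OF measurable_fst] measurable_compose[OF measurable_snd] measurable_restrict_space1)
    have "(\<lambda>p. (f p, fst (snd p), snd (snd p))) \<in> borel_measurable M" by measurable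
    then show ?thesis by simp
  qed
  have \<phi>_meas[measurable]: "\<phi> \<in> ?U \<Otimes>\<^sub>M N \<rightarrow>\<^sub>M structural_space Y T X"
  proof (rule measurable_structural_spaceI)
    show "\<phi> \<in> ?U \<Otimes>\<^sub>M N \<rightarrow>\<^sub>M structural_product Y T X"
      unfolding \<phi>_def structural_product_def N_def[symmetric]
      by (intro measurable_Pair measurable_restrict measurable_snd measurable_compose[OF pair_N Q'_meas])
    \<comment> \<open>Evaluating a path at the treatment need not be product-measurable, but along
      \<open>\<phi>\<close> it collapses to the jointly measurable \<open>Q'\<close>.\<close>
    show "(\<lambda>p. observe (\<phi> p)) \<in> borel_measurable (?U \<Otimes>\<^sub>M N)"
      by (subst measurable_cong[OF obs_\<phi>]) (auto intro!: into_borel)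
  qed
  define S where "S = distr (?U \<Otimes>\<^sub>M \<nu>) (structural_space Y T X) \<phi>"
  have \<phi>_meas'[measurable]: "\<phi> \<in> ?U \<Otimes>\<^sub>M \<nu> \<rightarrow>\<^sub>M structural_space Y T X" by measurable
  interpret S: prob_space S unfolding S_def by (rule UN.prob_space_distr) fact
  have sets_S[measurable_cong]: "sets S = sets (structural_space Y T X)" by (simp add: S_def)

  have "distr S (restrict_space borel ?W) observe = P"
  proof (rule measure_eqI)
    fix A assume "A \<in> sets (distr S (restrict_space borel ?W) observe)"
    then have A: "A \<in> sets (restrict_space borel ?W)" "A \<in> sets P" by (simp_all add: sets_P)
    have "?W \<in> sets borel" using Y T X by (auto simp flip: borel_prod)
    with A have A_borel: "A \<in> sets borel" "A \<subseteq> ?W" by (auto simp: sets_restrict_space_iff)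
    \<comment> \<open>\<open>P\<close> carries the trace of the Borel sets on \<open>?W\<close>,
      while the coupling lives on \<open>borel \<Otimes>\<^sub>M N\<close>; the event must be
      measurable for both.\<close>
    have A': "A \<in> sets (borel \<Otimes>\<^sub>M N)"
    proof -
      have "(\<lambda>p. (fst p, snd p)) -` A \<inter> space (borel \<Otimes>\<^sub>M N) \<in> sets (borel \<Otimes>\<^sub>M N)"
        by (rule measurable_sets[OF into_borel A_borel(1)]) auto
      also have "(\<lambda>p. (fst p, snd p)) -` A \<inter> space (borel \<Otimes>\<^sub>M N) = A"
        using A_borel(2) by (auto simp: space_pair_measure space_N)
      finally show ?thesis .
    qed
    have meas: "(\<lambda>p. (Q p, snd p)) \<in> ?U \<Otimes>\<^sub>M \<nu> \<rightarrow>\<^sub>M borel \<Otimes>\<^sub>M N" "(\<lambda>p. (Q' p, snd p)) \<in> ?U \<Otimes>\<^sub>M \<nu> \<rightarrow>\<^sub>M borel \<Otimes>\<^sub>M N"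
      by measurable
    have "emeasure (distr S (restrict_space borel ?W) observe) A = emeasure (distr (?U \<Otimes>\<^sub>M \<nu>) (restrict_space borel ?W) (observe \<circ> \<phi>)) A"
      unfolding S_def by (subst distr_distr) (auto simp: measurable_observe)
    also have "\<dots> = emeasure (?U \<Otimes>\<^sub>M \<nu>) ((observe \<circ> \<phi>) -` A \<inter> space (?U \<Otimes>\<^sub>M \<nu>))"
      by (rule emeasure_distr[OF measurable_comp[OF \<phi>_meas' measurable_observe] A(1)])
    also have "(observe \<circ> \<phi>) -` A \<inter> space (?U \<Otimes>\<^sub>M \<nu>) = (\<lambda>p. (Q' p, snd p)) -` A \<inter> space (?U \<Otimes>\<^sub>M \<nu>)"
      using obs_\<phi> by (auto simp: space_pair_measure space_\<nu>)
    also have "emeasure (?U \<Otimes>\<^sub>M \<nu>) \<dots> = emeasure (?U \<Otimes>\<^sub>M \<nu>) ((\<lambda>p. (Q p, snd p)) -` A \<inter> space (?U \<Otimes>\<^sub>M \<nu>))"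
      using Q'_eq by (intro emeasure_eq_AE measurable_sets[OF meas(1) A'] measurable_sets[OF meas(2) A']) (auto elim!: eventually_mono)
    also have "\<dots> = emeasure (distr P (borel \<Otimes>\<^sub>M N) (\<lambda>w. w)) A"
      unfolding Q_law[symmetric] by (rule emeasure_distr[OF meas(1) A', symmetric])
    also have "\<dots> = emeasure P ((\<lambda>w. w) -` A \<inter> space P)"
      by (rule emeasure_distr[OF id_BN A'])
    also have "(\<lambda>w. w) -` A \<inter> space P = A"
      using sets.sets_into_space[OF A(2)] by auto
    finally show "emeasure (distr S (restrict_space borel ?W) observe) A = emeasure P A" .
  qed (simp add: sets_P)
  moreover have "S \<in> structural_UC Y T X"
    unfolding structural_UC_def
  proof (intro CollectI conjI ballI S.prob_space_axioms sets_S)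
    fix t assume t: "t \<in> T"
    have id_S: "(\<lambda>\<omega>. \<omega>) \<in> S \<rightarrow>\<^sub>M structural_product Y T X"
      using measurable_id_structural_product sets_S by (simp cong: measurable_cong_sets)
    have proj: "(\<lambda>(y, _, _). y t) \<in> structural_product Y T X \<rightarrow>\<^sub>M restrict_space borel Y"
      "(\<lambda>(_, d, _). d) \<in> structural_product Y T X \<rightarrow>\<^sub>M restrict_space borel T"
      "(\<lambda>(_, _, x). x) \<in> structural_product Y T X \<rightarrow>\<^sub>M restrict_space borel X"
      unfolding structural_product_def using t by measurable
    have to_borel: "f \<in> borel_measurable S" if "f \<in> structural_product Y T X \<rightarrow>\<^sub>M restrict_space borel V"
      for f :: "('t \<Rightarrow> real) \<times> 't \<times> 'x \<Rightarrow> 'v::euclidean_space" and V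
      using measurable_compose[OF id_S that] by (auto simp: measurable_restrict_space2_iff)
    note S_meas = proj[THEN to_borel]
    show "cond_indep_var S borel (\<lambda>(y, _, _). y t) borel (\<lambda>(_, d, _). d) borel (\<lambda>(_, _, x). x)"
    proof (rule cond_indep_varI_kernel[OF S.prob_space_axioms S_meas])
      fix A :: "real set" assume [measurable]: "A \<in> sets borel"
      \<comment> \<open>The probability of \<open>Y(t) \<in> A\<close> at covariate value
        \<open>x\<close>, averaged over \<open>u\<close> alone. The value 0 off \<open>X\<close>
        extends it to a Borel function on the whole type.\<close>
      define h where "h x = (if x \<in> X then \<integral>u. indicator A (Q' (u, t, x)) \<partial>?U else 0 :: real)" for x
      have Qt: "(\<lambda>p. Q' (snd p, t, fst p)) \<in> borel_measurable (restrict_space borel X \<Otimes>\<^sub>M ?U)"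
        by (rule measurable_compose[OF _ Q'_borel]) (use t in \<open>auto simp: N_def space_restrict_space\<close>)
      have h_borel[measurable]: "h \<in> borel_measurable borel"
      proof -
        have "(\<lambda>x. \<integral>u. indicator A (Q' (u, t, x)) \<partial>?U :: real) \<in> borel_measurable (restrict_space borel X)"
          by (rule U.borel_measurable_lebesgue_integral) (use Qt in \<open>simp add: case_prod_beta'\<close>)
        then show ?thesis unfolding h_def using X
          by (subst measurable_If_restrict_space_iff) auto
      qed
      have h_bd: "\<bar>h x\<bar> \<le> 1" for x
      proof (cases "x \<in> X")
        case True
        have [measurable]: "(\<lambda>u. Q' (u, t, x)) \<in> borel_measurable ?U"
          using measurable_compose[OF measurable_Pair1' Qt] True by (simp add: space_restrict_space)
        have "integrable ?U (\<lambda>u. indicator A (Q' (u, t, x)) :: real)"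
          by (rule U.integrable_const_bound[of _ 1]) (auto simp: indicator_def)
        then have "(\<integral>u. indicator A (Q' (u, t, x)) \<partial>?U) \<le> (\<integral>u. 1 \<partial>?U :: real)"
          by (rule integral_mono) (auto simp: indicator_def)
        moreover have "0 \<le> (\<integral>u. indicator A (Q' (u, t, x)) \<partial>?U :: real)"
          by (rule Bochner_Integration.integral_nonneg) simp
        ultimately show ?thesis using True U.prob_space by (simp add: h_def)
      qed (simp add: h_def)
      show "\<exists>h\<in>borel_measurable borel. (\<forall>z\<in>space borel. \<bar>h z\<bar> \<le> 1) \<and>
        (\<forall>B\<in>sets borel. \<forall>C\<in>sets borel.
          (\<integral>\<omega>. indicator A (case \<omega> of (y, _, _) \<Rightarrow> y t) * indicator B (case \<omega> of (_, d, _) \<Rightarrow> d) *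
              indicator C (case \<omega> of (_, _, x) \<Rightarrow> x) \<partial>S) =
          (\<integral>\<omega>. h (case \<omega> of (_, _, x) \<Rightarrow> x) * indicator B (case \<omega> of (_, d, _) \<Rightarrow> d) *
              indicator C (case \<omega> of (_, _, x) \<Rightarrow> x) \<partial>S :: real))"
      proof (intro bexI[OF _ h_borel] conjI ballI h_bd)
        fix B :: "'t set" and C :: "'x set" assume [measurable]: "B \<in> sets borel" "C \<in> sets borel"
        note [measurable] = S_meas[unfolded measurable_cong_sets[OF sets_S refl]]
        show "(\<integral>\<omega>. indicator A (case \<omega> of (y, _, _) \<Rightarrow> y t) * indicator B (case \<omega> of (_, d, _) \<Rightarrow> d) *
              indicator C (case \<omega> of (_, _, x) \<Rightarrow> x) \<partial>S) =
          (\<integral>\<omega>. h (case \<omega> of (_, _, x) \<Rightarrow> x) * indicator B (case \<omega> of (_, d, _) \<Rightarrow> d) *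
              indicator C (case \<omega> of (_, _, x) \<Rightarrow> x) \<partial>S :: real)" (is "(\<integral>\<omega>. ?l \<omega> \<partial>S) = (\<integral>\<omega>. ?r \<omega> \<partial>S)")
        proof -
          have lm: "?l \<in> borel_measurable (structural_space Y T X)" "?r \<in> borel_measurable (structural_space Y T X)"
            by measurable
          have int: "integrable (?U \<Otimes>\<^sub>M \<nu>) (\<lambda>(u, z). ?l (\<phi> (u, z)))" "integrable (?U \<Otimes>\<^sub>M \<nu>) (\<lambda>(u, z). ?r (\<phi> (u, z)))"
            by (rule UN.integrable_const_bound[of _ 1];
                use lm \<phi>_meas' h_bd in \<open>auto simp: indicator_def split: prod.split intro!: measurable_compose[OF \<phi>_meas']\<close>)+
          have "(\<integral>\<omega>. ?l \<omega> \<partial>S) = (\<integral>p. ?l (\<phi> p) \<partial>(?U \<Otimes>\<^sub>M \<nu>))"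
            unfolding S_def by (rule integral_distr) (use lm in auto)
          also have "\<dots> = (\<integral>(u, z). ?l (\<phi> (u, z)) \<partial>(?U \<Otimes>\<^sub>M \<nu>))"
            by (rule Bochner_Integration.integral_cong) (simp_all only: split_paired_all case_prod_conv)
          also have "\<dots> = (\<integral>z. (\<integral>u. ?l (\<phi> (u, z)) \<partial>?U) \<partial>\<nu>)"
            by (rule UN.integral_snd[OF int(1), symmetric])
          also have "\<dots> = (\<integral>z. (\<integral>u. ?r (\<phi> (u, z)) \<partial>?U) \<partial>\<nu>)"
          \<comment> \<open>With treatment and covariates fixed, the indicators of \<open>B\<close>
            and \<open>C\<close> are constants, and the \<open>u\<close>-average of the indicator of
            \<open>A\<close> is \<open>h x\<close> by definition.\<close>
          proof (rule Bochner_Integration.integral_cong[OF refl])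
            fix z assume "z \<in> space \<nu>"
            then obtain t' x where z: "z = (t', x)" "t' \<in> T" "x \<in> X" by (auto simp: space_\<nu> space_N)
            show "(\<integral>u. ?l (\<phi> (u, z)) \<partial>?U) = (\<integral>u. ?r (\<phi> (u, z)) \<partial>?U)"
              using z t by (simp add: \<phi>_def h_def U.prob_space)
          qed
          also have "\<dots> = (\<integral>(u, z). ?r (\<phi> (u, z)) \<partial>(?U \<Otimes>\<^sub>M \<nu>))"
            by (rule UN.integral_snd[OF int(2)])
          also have "\<dots> = (\<integral>p. ?r (\<phi> p) \<partial>(?U \<Otimes>\<^sub>M \<nu>))"
            by (rule Bochner_Integration.integral_cong) (simp_all only: split_paired_all case_prod_conv)
          also have "\<dots> = (\<integral>\<omega>. ?r \<omega> \<partial>S)"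
            unfolding S_def by (rule integral_distr[symmetric]) (use lm in auto)
          finally show ?thesis .
        qed
      qed
    qed
  qed
  ultimately show "P \<in> model_UC Y T X" unfolding model_UC_def by (metis image_eqI)
qed

theorem theorem1:
  fixes Y :: "real set" and T :: "real set" and X :: "'x::euclidean_space set"
  assumes "Y \<in> sets borel" and "bounded Y" and "T \<in> sets borel" and "X \<in> sets borel"
  shows "globally_just_identified (Y \<times> T \<times> X) (model_UC Y T X) \<and>
         (\<forall>P \<in> model_UC Y T X. locally_just_identified (Y \<times> T \<times> X) (model_UC Y T X) P)"
proof -
  have "model_UC Y T X = prob_measures (Y \<times> T \<times> X)"
    using model_UC_subset prob_measures_subset_model_UC[OF assms] by (rule antisym)
  then show ?thesis
    by (simp add: globally_just_identified_def locally_just_identified_all_measures)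
qed

end
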